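(* Let $A\in\mathbb{R}^{n\times n}$ and $\tau_1,\ldots,\tau_\nu\in\mathbb{C}$ be such that $A$ and all $A-\tau_iI$ are nonsingular, and let $0\neq B\in\mathbb{R}^{n\times p}$. Let $\widetilde{A}^{-1}$ denote an $n\times n$ matrix (a computed approximation to $A^{-1}$), and put $F=\widetilde{A}^{-1}-A^{-1}$. For $i=1,\ldots,\nu$ let $$Y_i=(I-\tau_iA^{-1})^{-1}B,\quad \widetilde{Y}_i=(I-\tau_i\widetilde{A}^{-1})^{-1}B,\quad X_i=A^{-1}Y_i,\quad \widetilde{X}_i=\widetilde{A}^{-1}\widetilde{Y}_i,$$ so that $X_i$ and $\widetilde{X}_i$ are the exact and the computed solutions of $(A-\tau_iI)X_i=B$. Let $\varepsilon_i=\|\tau_i(I-\tau_iA^{-1})^{-1}F\|$. Then, if $\varepsilon_i\ll 1$, up to a term of second order in $\varepsilon_i$, $$\frac{\|X_i-\widetilde{X}_i\|}{\|X_i\|}\lessapprox\kappa(A)\,\|(I-\tau_iA^{-1})^{-1}\|\cdot\frac{\|\widetilde{A}^{-1}-A^{-1}\|}{\|A^{-1}\|},\quad i=1,2,\ldots,\nu.$$ Precisely: for each $i$, with $A$ and $\tau_i$ fixed, as $\varepsilon_i\to 0$, $$\frac{\|X_i-\widetilde{X}_i\|}{\|X_i\|}\le\kappa(A)\,\|(I-\tau_iA^{-1})^{-1}\|\cdot\frac{\|\widetilde{A}^{-1}-A^{-1}\|}{\|A^{-1}\|}+\mathcal{O}(\varepsilon_i^2).$$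
   Context: $\|\cdot\|$ denotes a vector norm or its induced matrix norm (for $n\times p$ matrices, the operator norm induced by vector norms on $\mathbb{C}^p$ and $\mathbb{C}^n$, the latter being the one inducing the norm of $n\times n$ matrices). $\kappa(A)=\|A\|\cdot\|A^{-1}\|$ is the condition number of $A$. The symbol $\widetilde{A}^{-1}$ is a single symbol for the computed approximation of $A^{-1}$. The symbol $\lessapprox$ means "at most, after omitting the term of order $\mathcal{O}(\varepsilon_i^2)$". *)

theory Defs
  imports "HOL-Analysis.Analysis"
begin

definition vector_norm :: "(complex^'n \<Rightarrow> real) \<Rightarrow> bool" where
  "vector_norm N \<longleftrightarrow>
     (\<forall>x. 0 \<le> N x) \<and> (\<forall>x. N x = 0 \<longleftrightarrow> x = 0) \<and>
     (\<forall>c x. N (c *s x) = cmod c * N x) \<and>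
     (\<forall>x y. N (x + y) \<le> N x + N y)"

text \<open>The domain carries \<open>Nd\<close>, the codomain \<open>Nc\<close>. The supremum is over a nonempty bounded
  set when both are vector norms, since the index types are nonempty and finite.\<close>

definition induced_norm ::
  "(complex^'p \<Rightarrow> real) \<Rightarrow> (complex^'n \<Rightarrow> real) \<Rightarrow> complex^'p^'n \<Rightarrow> real" where
  "induced_norm Nd Nc M = (SUP x\<in>{x. Nd x = 1}. Nc (M *v x))"

definition condition_number :: "(complex^'n \<Rightarrow> real) \<Rightarrow> complex^'n^'n \<Rightarrow> real" where
  "condition_number N A = induced_norm N N A * induced_norm N N (matrix_inv A)"

abbreviation cmatrix :: "real^'p^'n \<Rightarrow> complex^'p^'n" where
  "cmatrix \<equiv> map_matrix complex_of_real"

text \<open>In the next three definitions \<open>K\<close> is either the exact inverse of \<open>A\<close> or its computed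
  approximation. Note that \<open>mat t\<close> is \<open>t\<close> times the identity, so \<open>mat t ** K\<close> is the
  scalar multiple \<open>t K\<close>.\<close>

definition resolvent :: "complex \<Rightarrow> complex^'n^'n \<Rightarrow> complex^'n^'n" where
  "resolvent t K = matrix_inv (mat 1 - mat t ** K)"

definition sol_Y :: "complex \<Rightarrow> complex^'n^'n \<Rightarrow> complex^'p^'n \<Rightarrow> complex^'p^'n" where
  "sol_Y t K B = resolvent t K ** B"

definition sol_X :: "complex \<Rightarrow> complex^'n^'n \<Rightarrow> complex^'p^'n \<Rightarrow> complex^'p^'n" where
  "sol_X t K B = K ** sol_Y t K B"

text \<open>\<open>Ainv\<close> is the exact inverse, \<open>Kt\<close> the computed one, and \<open>Kt - Ainv\<close> the error \<open>F\<close>.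
  Since \<open>I - t Kt = (I - t Ainv) (I - t (I - t Ainv)\<^sup>-\<^sup>1 F)\<close>, the matrix \<open>I - t Kt\<close> is
  nonsingular as soon as \<open>I - t Ainv\<close> is and this quantity is below 1; so \<open>resolvent t Kt\<close>
  is then a true inverse.\<close>

definition perturbation_eps ::
  "(complex^'n \<Rightarrow> real) \<Rightarrow> complex \<Rightarrow> complex^'n^'n \<Rightarrow> complex^'n^'n \<Rightarrow> real" where
  "perturbation_eps N t Ainv Kt =
     induced_norm N N (mat t ** resolvent t Ainv ** (Kt - Ainv))"

end

theory Submission
  imports Defs
begin

text \<open>
  Fix one shift \<open>t\<close> and write \<open>K\<close> for the exact inverse of \<open>A\<close>, \<open>Kt\<close> for the computed one,
  \<open>F = Kt - K\<close>, \<open>G = (I - t K)\<^sup>-\<^sup>1\<close> and \<open>E = t G F\<close>, so that \<open>\<epsilon> = \<parallel>E\<parallel>\<close>. Rather than expanding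
  \<open>(I - t Kt)\<^sup>-\<^sup>1\<close> in a Neumann series, the proof shows that the error \<open>D = Xt - X\<close> solves the
  fixed point equation \<open>D = G F A X + E D\<close> (lemma \<open>error_fixed_point\<close>).

  The first summand \<open>L = G F A X\<close> gives the first-order bound: \<open>\<parallel>L\<parallel>\<close> is at most
  \<open>\<parallel>G\<parallel> \<parallel>F\<parallel> \<parallel>A\<parallel> \<parallel>X\<parallel>\<close>, and \<open>\<parallel>A\<parallel> = \<kappa>(A) / \<parallel>K\<parallel>\<close>. When \<open>\<epsilon> < 1/2\<close>, the equation first yields
  the crude bound \<open>\<parallel>D\<parallel> \<le> 2 \<parallel>L\<parallel>\<close> and then, inserted into itself, \<open>\<parallel>D\<parallel> \<le> \<parallel>L\<parallel> + 2 \<epsilon> \<parallel>L\<parallel>\<close>.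

  The remainder \<open>2 \<epsilon> \<parallel>L\<parallel>\<close> is of second order in \<open>\<epsilon>\<close>, uniformly in \<open>B\<close> and \<open>Kt\<close>, because
  \<open>\<parallel>G F\<parallel> = \<epsilon> / |t|\<close> for \<open>t \<noteq> 0\<close>; the constant is \<open>C = 2 \<parallel>A\<parallel> / |t|\<close>. For \<open>t = 0\<close> the matrix \<open>E\<close>
  vanishes, there is no remainder, and the convention \<open>x / 0 = 0\<close> lets the same formula
  for \<open>C\<close> cover this case.

  The supremum defining an induced norm is well behaved only if it is over a bounded set,
  which rests on the equivalence of any vector norm on \<open>\<complex>\<^sup>n\<close> with the Euclidean one.
\<close>

section \<open>Vector norms and induced matrix norms\<close>

context
  fixes N :: "complex^'n \<Rightarrow> real"
  assumes N: "vector_norm N"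
begin

lemma vector_norm_nonneg [simp]: "0 \<le> N x"
  and vector_norm_eq_0_iff: "N x = 0 \<longleftrightarrow> x = 0"
  and vector_norm_scale: "N (c *s x) = cmod c * N x"
  and vector_norm_triangle: "N (x + y) \<le> N x + N y"
  using N unfolding vector_norm_def by auto

lemma vector_norm_zero [simp]: "N 0 = 0"
  by (simp add: vector_norm_eq_0_iff)

lemma vector_norm_sum: "N (sum f S) \<le> (\<Sum>i\<in>S. N (f i))"
proof (induction S rule: infinite_finite_induct)
  case (insert i S)
  then show ?case using vector_norm_triangle[of "f i" "sum f S"] by simp
qed auto

text \<open>One half of the equivalence with the Euclidean norm, from expanding \<open>x\<close> in the standard
  basis.\<close>

lemma vector_norm_le_norm: "\<exists>C. \<forall>x. N x \<le> C * norm x"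
proof (intro exI allI)
  fix x
  have "N x = N (\<Sum>i\<in>UNIV. x $ i *s axis i 1)"
    by (simp add: basis_expansion)
  also have "\<dots> \<le> (\<Sum>i\<in>UNIV. cmod (x $ i) * N (axis i 1))"
    using vector_norm_sum[of "\<lambda>i. x $ i *s axis i 1" UNIV] by (simp add: vector_norm_scale)
  also have "\<dots> \<le> (\<Sum>i\<in>UNIV. norm x * N (axis i 1))"
    by (intro sum_mono mult_right_mono) (auto simp: Finite_Cartesian_Product.norm_nth_le)
  finally show "N x \<le> (\<Sum>i\<in>UNIV. N (axis i 1)) * norm x"
    by (simp add: sum_distrib_left[symmetric] mult.commute)
qed

lemma vector_norm_scaleR: "N (r *\<^sub>R x) = \<bar>r\<bar> * N x"
proof -
  have "r *\<^sub>R x = complex_of_real r *s x"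
    by (simp add: vec_eq_iff scaleR_conv_of_real[where 'a=complex])
  then show ?thesis by (simp add: vector_norm_scale)
qed

lemma vector_norm_minus: "N (- x) = N x"
  using vector_norm_scaleR[of "-1" x] by simp

lemma vector_norm_continuous: "continuous_on S N"
proof -
  obtain C where C: "\<And>x. N x \<le> C * norm x" using vector_norm_le_norm by blast
  have tri: "N x - N y \<le> C * norm (x - y)" for x y
    using vector_norm_triangle[of "x - y" y] C[of "x - y"] by simp
  have "\<bar>N x - N y\<bar> \<le> C * norm (x - y)" for x y
    using tri[of x y] tri[of y x] by (simp add: norm_minus_commute abs_le_iff)
  moreover have "C * norm (x - y) \<le> max 0 C * norm (x - y)" for x y :: "complex^'n"
    by (intro mult_right_mono) auto
  ultimately have "dist (N x) (N y) \<le> max 0 C * dist x y" for x y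
    by (metis dist_norm order_trans real_norm_def)
  then have "(max 0 C)-lipschitz_on S N"
    by (intro lipschitz_onI) auto
  then show ?thesis by (rule lipschitz_on_continuous_on)
qed

text \<open>The other half of the equivalence of norms: on the compact Euclidean unit sphere the
  continuous function \<open>N\<close> attains its minimum, which is positive by definiteness.\<close>

lemma norm_le_vector_norm: "\<exists>C\<ge>0. \<forall>x. norm x \<le> C * N x"
proof -
  have "sphere (0 :: complex^'n) 1 \<noteq> {}" by simp
  then obtain z where z: "z \<in> sphere 0 1" and le: "\<And>y. y \<in> sphere 0 1 \<Longrightarrow> N z \<le> N y"
    using continuous_attains_inf[OF compact_sphere _ vector_norm_continuous] by blast
  have "z \<noteq> 0" using z by auto
  then have pos: "N z > 0"
    using vector_norm_eq_0_iff[of z] vector_norm_nonneg[of z] by linarith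
  have "norm x \<le> (1 / N z) * N x" for x
  proof (cases "x = 0")
    case False
    have "N z \<le> N ((1 / norm x) *\<^sub>R x)" using False by (intro le) simp
    then show ?thesis using False pos by (simp add: vector_norm_scaleR field_simps)
  qed simp
  then show ?thesis using pos by (intro exI[of _ "1 / N z"]) auto
qed

lemma vector_norm_unit: "\<exists>x. N x = 1"
proof -
  define e :: "complex^'n" where "e = axis undefined 1"
  have "e \<noteq> 0" by (simp add: e_def axis_eq_0_iff)
  then have "N ((1 / N e) *\<^sub>R e) = 1"
    using vector_norm_eq_0_iff[of e] by (simp add: vector_norm_scaleR)
  then show ?thesis by blast
qed

end

lemma mat_mult_vector: "mat c *v x = (c :: complex) *s x"
  by (vector matrix_vector_mult_def mat_def) 
     (simp add: if_distrib[where f="\<lambda>y. y * _"] sum.delta' cong: if_cong)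

context
  fixes Nd :: "complex^'p \<Rightarrow> real" and Nc :: "complex^'n \<Rightarrow> real"
  assumes Nd: "vector_norm Nd" and Nc: "vector_norm Nc"
begin

text \<open>The \<open>Nd\<close>-unit sphere is bounded in the Euclidean norm, and \<open>M\<close> followed by \<open>Nc\<close> is
  Euclidean-bounded. This makes the supremum in \<open>induced_norm\<close> a genuine one.\<close>

lemma induced_norm_bdd_above: "bdd_above ((\<lambda>x. Nc (M *v x)) ` {x. Nd x = 1})"
proof -
  obtain C where C: "C \<ge> 0" "\<And>x. norm x \<le> C * Nd x"
    using norm_le_vector_norm[OF Nd] by blast
  obtain D where D: "\<And>y. Nc y \<le> D * norm y"
    using vector_norm_le_norm[OF Nc] by blast
  have "linear ((*v) M)"
    by (rule linearI) (vector matrix_vector_mult_def sum.distrib scaleR_sum_right distrib_left)+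
  then obtain E where E: "\<And>x. norm (M *v x) \<le> E * norm x"
    using linear_bounded by blast
  show ?thesis
  proof (rule bdd_aboveI2)
    fix x assume "x \<in> {x. Nd x = 1}"
    then have x: "norm x \<le> C" using C(2)[of x] by simp
    have "Nc (M *v x) \<le> \<bar>D\<bar> * norm (M *v x)"
      using D[of "M *v x"] by (meson abs_ge_self mult_right_mono norm_ge_zero order_trans)
    also have "norm (M *v x) \<le> \<bar>E\<bar> * norm x"
      using E[of x] by (meson abs_ge_self mult_right_mono norm_ge_zero order_trans)
    also have "\<bar>E\<bar> * norm x \<le> \<bar>E\<bar> * C"
      using x by (intro mult_left_mono) auto
    finally show "Nc (M *v x) \<le> \<bar>D\<bar> * (\<bar>E\<bar> * C)" by (simp add: mult_left_mono)
  qed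
qed

lemma induced_norm_bound: "Nc (M *v x) \<le> induced_norm Nd Nc M * Nd x"
proof (cases "x = 0")
  case True
  then show ?thesis using Nd Nc by simp
next
  case False
  define r where "r = Nd x"
  have r: "r > 0"
    using False vector_norm_eq_0_iff[OF Nd, of x] vector_norm_nonneg[OF Nd, of x]
    unfolding r_def by linarith
  define c where "c = complex_of_real (1 / r)"
  have c: "cmod c = 1 / r" using r unfolding c_def norm_of_real by simp
  have "Nd (c *s x) = 1" using r c by (simp add: vector_norm_scale[OF Nd] r_def[symmetric])
  then have "Nc (M *v (c *s x)) \<le> induced_norm Nd Nc M"
    unfolding induced_norm_def by (intro cSUP_upper induced_norm_bdd_above) simp
  then have "Nc (M *v x) / r \<le> induced_norm Nd Nc M"
    by (simp add: vec.scale vector_norm_scale[OF Nc] c)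
  then show ?thesis using r by (simp add: r_def[symmetric] field_simps)
qed

lemma induced_norm_least:
  assumes "\<And>x. Nc (M *v x) \<le> b * Nd x"
  shows "induced_norm Nd Nc M \<le> b"
  unfolding induced_norm_def
proof (rule cSUP_least)
  show "{x. Nd x = 1} \<noteq> {}" using vector_norm_unit[OF Nd] by simp
  show "Nc (M *v x) \<le> b" if "x \<in> {x. Nd x = 1}" for x
    using assms[of x] that by simp
qed

lemma induced_norm_nonneg: "0 \<le> induced_norm Nd Nc M"
proof -
  obtain x where "Nd x = 1" using vector_norm_unit[OF Nd] by blast
  then show ?thesis
    using induced_norm_bound[of M x] vector_norm_nonneg[OF Nc, of "M *v x"] by simp
qed

lemma induced_norm_pos:
  assumes "M \<noteq> 0" shows "0 < induced_norm Nd Nc M"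
proof -
  obtain x where "M *v x \<noteq> 0 *v x" using assms by (auto simp: matrix_eq)
  then have "0 < Nc (M *v x)"
    using vector_norm_eq_0_iff[OF Nc, of "M *v x"] vector_norm_nonneg[OF Nc, of "M *v x"]
    by auto
  also have "\<dots> \<le> induced_norm Nd Nc M * Nd x" by (rule induced_norm_bound)
  finally show ?thesis
    using vector_norm_nonneg[OF Nd, of x] induced_norm_nonneg[of M]
    by (auto simp: zero_less_mult_iff)
qed

lemma induced_norm_triangle:
  "induced_norm Nd Nc (M + M') \<le> induced_norm Nd Nc M + induced_norm Nd Nc M'"
proof (rule induced_norm_least)
  fix x
  have "Nc ((M + M') *v x) \<le> Nc (M *v x) + Nc (M' *v x)"
    by (simp add: matrix_vector_mult_add_rdistrib vector_norm_triangle[OF Nc])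
  also have "\<dots> \<le> induced_norm Nd Nc M * Nd x + induced_norm Nd Nc M' * Nd x"
    by (intro add_mono induced_norm_bound)
  finally show "Nc ((M + M') *v x) \<le> (induced_norm Nd Nc M + induced_norm Nd Nc M') * Nd x"
    by (simp add: distrib_right)
qed

text \<open>This turns a bound on \<open>t G F\<close> into one on \<open>G F\<close>.\<close>

lemma induced_norm_scalar_mult:
  "cmod c * induced_norm Nd Nc M \<le> induced_norm Nd Nc (mat c ** M)"
proof (cases "c = 0")
  case False
  have "induced_norm Nd Nc M \<le> induced_norm Nd Nc (mat c ** M) / cmod c"
  proof (rule induced_norm_least)
    fix x
    have "cmod c * Nc (M *v x) \<le> induced_norm Nd Nc (mat c ** M) * Nd x"
      using induced_norm_bound[of "mat c ** M" x]
      by (simp add: matrix_vector_mul_assoc[symmetric] mat_mult_vector vector_norm_scale[OF Nc])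
    then show "Nc (M *v x) \<le> induced_norm Nd Nc (mat c ** M) / cmod c * Nd x"
      using False by (simp add: field_simps)
  qed
  then show ?thesis using False by (simp add: field_simps)
qed (simp add: induced_norm_nonneg)

end

lemma induced_norm_mult:
  assumes Np: "vector_norm Np" and Nm: "vector_norm Nm" and Nn: "vector_norm Nn"
  shows "induced_norm Np Nn (P ** M) \<le> induced_norm Nm Nn P * induced_norm Np Nm M"
proof (rule induced_norm_least[OF Np Nn])
  fix x
  have "Nn ((P ** M) *v x) \<le> induced_norm Nm Nn P * Nm (M *v x)"
    using induced_norm_bound[OF Nm Nn, of P "M *v x"] by (simp add: matrix_vector_mul_assoc)
  also have "\<dots> \<le> induced_norm Nm Nn P * (induced_norm Np Nm M * Np x)"
    by (intro mult_left_mono induced_norm_bound[OF Np Nm] induced_norm_nonneg[OF Nm Nn])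
  finally show "Nn ((P ** M) *v x) \<le> (induced_norm Nm Nn P * induced_norm Np Nm M) * Np x"
    by (simp add: mult.assoc)
qed

section \<open>Matrix algebra\<close>

lemma matrix_diff_ldistrib: "A ** (B - C) = A ** B - A ** (C :: 'a::ring_1^'p^'n)"
  by (simp add: matrix_eq matrix_vector_mul_assoc[symmetric] algebra_simps)

lemma matrix_diff_rdistrib: "(A - B) ** C = A ** C - B ** (C :: 'a::ring_1^'p^'n)"
  by (simp add: matrix_eq matrix_vector_mul_assoc[symmetric] algebra_simps)

lemma mat_commute: "mat c ** M = M ** mat (c :: complex)"
  by (simp add: matrix_eq matrix_vector_mul_assoc[symmetric] mat_mult_vector vec.scale)

lemma matrix_inv_inverse:
  fixes M :: "'a::field^'n^'n"
  assumes "invertible M"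
  shows "M ** matrix_inv M = mat 1" "matrix_inv M ** M = mat 1"
proof -
  have "M ** matrix_inv M = mat 1 \<and> matrix_inv M ** M = mat 1"
    unfolding matrix_inv_def using assms unfolding invertible_def by (rule someI_ex)
  then show "M ** matrix_inv M = mat 1" "matrix_inv M ** M = mat 1" by auto
qed

lemma cmatrix_invertible:
  fixes A :: "real^'n^'n"
  assumes "invertible A" shows "invertible (cmatrix A)"
proof -
  have mult: "cmatrix (P ** Q) = cmatrix P ** cmatrix Q" for P Q :: "real^'n^'n"
    by (simp add: vec_eq_iff matrix_matrix_mult_def)
  have one: "cmatrix (mat 1 :: real^'n^'n) = mat 1"
    by (simp add: vec_eq_iff mat_def)
  show ?thesis
    using assms unfolding invertible_def by (metis mult one)
qed

text \<open>A kernel vector \<open>x\<close> of \<open>I - E\<close> is fixed by \<open>E\<close>, which strictly shrinks nonzero vectors;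
  in finite dimension a trivial kernel suffices, so no Neumann series is summed.\<close>

lemma invertible_one_minus:
  assumes N: "vector_norm N" and small: "induced_norm N N E < 1"
  shows "invertible (mat 1 - E)"
proof -
  have "x = 0" if "(mat 1 - E) *v x = 0" for x
  proof (rule ccontr)
    assume "x \<noteq> 0"
    then have pos: "N x > 0"
      using vector_norm_eq_0_iff[OF N, of x] vector_norm_nonneg[OF N, of x] by linarith
    have "E *v x = x" using that by (simp add: algebra_simps)
    then have "N x \<le> induced_norm N N E * N x"
      using induced_norm_bound[OF N N, of E x] by simp
    then show False using small pos by simp
  qed
  then show ?thesis
    by (simp add: invertible_left_inverse matrix_left_invertible_ker)
qed

section \<open>Solving the shifted system\<close>

text \<open>Here \<open>I - t K = (A - t I) K\<close> is a product of invertible matrices.\<close>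

lemma invertible_one_minus_scaled_inverse:
  fixes A K :: "complex^'n^'n"
  assumes "invertible (A - mat t)" "K ** A = mat 1" "A ** K = mat 1"
  shows "invertible (mat 1 - mat t ** K)"
proof -
  have "mat 1 - mat t ** K = (A - mat t) ** K"
    by (simp add: matrix_diff_rdistrib assms)
  moreover have "invertible K" using assms unfolding invertible_def by blast
  ultimately show ?thesis using assms(1) by (simp add: invertible_mult)
qed

lemma resolvent_inverse:
  assumes "invertible (mat 1 - mat t ** K)"
  shows "(mat 1 - mat t ** K) ** resolvent t K = mat 1"
    "resolvent t K ** (mat 1 - mat t ** K) = mat 1"
  using matrix_inv_inverse[OF assms] by (simp_all add: resolvent_def)

text \<open>\<open>I - t K\<close> commutes with \<open>K\<close>, so it can be moved past \<open>K\<close> to cancel the resolvent. The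
  lemma is applied to both the exact and the computed inverse, which is why \<open>K\<close> is not tied to
  a matrix \<open>A\<close>.\<close>

lemma one_minus_scaled_mult_sol_X:
  assumes "invertible (mat 1 - mat t ** K)"
  shows "(mat 1 - mat t ** K) ** sol_X t K B = K ** B"
proof -
  have "(mat 1 - mat t ** K) ** K = K ** (mat 1 - mat t ** K)"
    by (simp add: matrix_diff_rdistrib matrix_diff_ldistrib mat_commute matrix_mul_assoc[symmetric])
  then have "(mat 1 - mat t ** K) ** sol_X t K B
      = K ** ((mat 1 - mat t ** K) ** resolvent t K) ** B"
    by (simp add: sol_X_def sol_Y_def matrix_mul_assoc)
  then show ?thesis by (simp add: resolvent_inverse[OF assms])
qed

lemma sol_X_solves:
  assumes AK: "A ** K = mat 1" and inv: "invertible (mat 1 - mat t ** K)"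
  shows "(A - mat t) ** sol_X t K B = B"
proof -
  have "(A - mat t) ** sol_X t K B = ((A - mat t) ** K) ** resolvent t K ** B"
    by (simp add: sol_X_def sol_Y_def matrix_mul_assoc)
  also have "(A - mat t) ** K = mat 1 - mat t ** K"
    by (simp add: matrix_diff_rdistrib AK)
  finally show ?thesis by (simp add: resolvent_inverse[OF inv])
qed

text \<open>Since \<open>(I - t Kt) Xt = Kt B\<close>, \<open>(I - t K) X = K B\<close> and \<open>I - t Kt = (I - t K) - t F\<close>, the error
  satisfies \<open>(I - t Kt) D = F (B + t X)\<close>, and \<open>B + t X = A X\<close> because \<open>X\<close> solves the shifted system.
  Multiplying by \<open>G\<close> from the left turns \<open>I - t Kt\<close> into \<open>I - t G F\<close>.\<close>

lemma error_fixed_point: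
  fixes A K Kt :: "complex^'n^'n" and B :: "complex^'p^'n"
  assumes AK: "A ** K = mat 1"
    and inv: "invertible (mat 1 - mat t ** K)" and invt: "invertible (mat 1 - mat t ** Kt)"
  defines "X \<equiv> sol_X t K B" and "D \<equiv> sol_X t Kt B - sol_X t K B"
  shows "D = resolvent t K ** (Kt - K) ** (A ** X)
           + (mat t ** resolvent t K ** (Kt - K)) ** D"
proof -
  let ?G = "resolvent t K" and ?F = "Kt - K"
  have AX: "A ** X - mat t ** X = B"
    using sol_X_solves[OF AK inv] by (simp add: X_def matrix_diff_rdistrib)
  have split: "mat 1 - mat t ** Kt = (mat 1 - mat t ** K) - mat t ** ?F"
    by (simp add: matrix_diff_ldistrib)
  have "(mat 1 - mat t ** Kt) ** D = Kt ** B - (K ** B - mat t ** ?F ** X)"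
    unfolding D_def matrix_diff_ldistrib[of "mat 1 - mat t ** Kt"]
      one_minus_scaled_mult_sol_X[OF invt]
    unfolding split matrix_diff_rdistrib[of "mat 1 - mat t ** K"]
      one_minus_scaled_mult_sol_X[OF inv] X_def ..
  also have "\<dots> = ?F ** B + ?F ** (mat t ** X)"
    by (simp add: mat_commute[of t ?F] matrix_mul_assoc[symmetric] matrix_diff_rdistrib)
  also have "\<dots> = ?F ** (A ** X)"
    by (simp add: AX[symmetric] matrix_diff_ldistrib)
  finally have "?G ** ((mat 1 - mat t ** Kt) ** D) = ?G ** ?F ** (A ** X)"
    by (simp add: matrix_mul_assoc)
  moreover have "?G ** (mat 1 - mat t ** Kt) = mat 1 - mat t ** ?G ** ?F"
    using matrix_diff_ldistrib[of ?G "mat 1 - mat t ** K" "mat t ** ?F"]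
    by (simp add: split resolvent_inverse(2)[OF inv] matrix_mul_assoc mat_commute[of t ?G])
  ultimately have "(mat 1 - mat t ** ?G ** ?F) ** D = ?G ** ?F ** (A ** X)"
    by (simp add: matrix_mul_assoc)
  then show ?thesis
    by (simp add: matrix_diff_rdistrib algebra_simps)
qed

text \<open>The factorization \<open>I - t Kt = (I - t K) (I - t G F)\<close> reduces this to
  \<open>invertible_one_minus\<close>.\<close>

lemma invertible_perturbed:
  fixes K Kt :: "complex^'n^'n"
  assumes N: "vector_norm N" and inv: "invertible (mat 1 - mat t ** K)"
    and small: "perturbation_eps N t K Kt < 1"
  shows "invertible (mat 1 - mat t ** Kt)"
proof -
  let ?G = "resolvent t K" and ?F = "Kt - K"
  have "(mat 1 - mat t ** K) ** (mat 1 - mat t ** ?G ** ?F)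
      = (mat 1 - mat t ** K) - ((mat 1 - mat t ** K) ** ?G) ** (mat t ** ?F)"
    by (simp add: matrix_diff_ldistrib[of "mat 1 - mat t ** K"] matrix_mul_assoc mat_commute[of t ?G])
  also have "\<dots> = mat 1 - mat t ** Kt"
    by (simp add: resolvent_inverse[OF inv] matrix_diff_ldistrib)
  finally show ?thesis
    using invertible_mult[OF inv invertible_one_minus[OF N]] small
    unfolding perturbation_eps_def by metis
qed

section \<open>The error bound\<close>

text \<open>The quantitative core, with explicit constants. In the first-order term the factor
  \<open>\<kappa>(A) / \<parallel>K\<parallel>\<close> appears already cancelled to \<open>\<parallel>A\<parallel>\<close>.\<close>

lemma relative_error_bound:
  fixes A K Kt :: "complex^'n^'n" and B :: "complex^'p^'n"
  assumes Nn: "vector_norm Nn" and Np: "vector_norm Np"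
    and AK: "A ** K = mat 1"
    and inv: "invertible (mat 1 - mat t ** K)" and "B \<noteq> 0"
    and small: "perturbation_eps Nn t K Kt < 1 / 2"
  defines "X \<equiv> sol_X t K B" and "Xt \<equiv> sol_X t Kt B"
  shows "induced_norm Np Nn (X - Xt) / induced_norm Np Nn X
    \<le> induced_norm Nn Nn A * induced_norm Nn Nn (resolvent t K) * induced_norm Nn Nn (Kt - K)
      + (2 * induced_norm Nn Nn A / cmod t) * (perturbation_eps Nn t K Kt)\<^sup>2"
proof -
  let ?G = "resolvent t K" and ?F = "Kt - K"
  let ?n = "induced_norm Nn Nn" and ?m = "induced_norm Np Nn"
  define e where "e = perturbation_eps Nn t K Kt"
  define D where "D = Xt - X"
  define L where "L = ?G ** ?F ** (A ** X)"
  note nonneg = induced_norm_nonneg[OF Nn Nn] induced_norm_nonneg[OF Np Nn]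
  note mult = induced_norm_mult[OF Nn Nn Nn] induced_norm_mult[OF Np Nn Nn]
  have e: "0 \<le> e" "e < 1 / 2" "e = ?n (mat t ** ?G ** ?F)"
    using small nonneg(1) by (auto simp: e_def perturbation_eps_def)
  have "(A - mat t) ** X = B" unfolding X_def by (rule sol_X_solves[OF AK inv])
  then have "X \<noteq> 0" using \<open>B \<noteq> 0\<close> by (metis cancel_comm_monoid_add_class.diff_cancel matrix_diff_ldistrib)
  then have Xpos: "?m X > 0" by (rule induced_norm_pos[OF Np Nn])
  have "invertible (mat 1 - mat t ** Kt)"
    using invertible_perturbed[OF Nn inv] small by simp
  from error_fixed_point[OF AK inv this, of B]
  have D: "D = L + (mat t ** ?G ** ?F) ** D"
    by (simp add: D_def L_def X_def Xt_def)
  have "?m D \<le> ?m L + ?m ((mat t ** ?G ** ?F) ** D)"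
    using induced_norm_triangle[OF Np Nn, of L "(mat t ** ?G ** ?F) ** D"] D by simp
  also have "\<dots> \<le> ?m L + e * ?m D"
    using mult(2)[of "mat t ** ?G ** ?F" D] by (simp add: e)
  finally have fix_le: "?m D \<le> ?m L + e * ?m D" .
  \<comment> \<open>Bootstrap: the crude bound \<open>2 \<parallel>L\<parallel>\<close> is fed back into the right-hand side of \<open>fix_le\<close>.\<close>
  have "e * ?m D \<le> (1 / 2) * ?m D" using e nonneg(2) by (intro mult_right_mono) auto
  then have "?m D \<le> 2 * ?m L" using fix_le by linarith
  then have "e * ?m D \<le> e * (2 * ?m L)" using e by (intro mult_left_mono)
  then have D_le: "?m D \<le> ?m L + 2 * (e * ?m L)" using fix_le by simp
  \<comment> \<open>Two estimates of \<open>L\<close>: the first-order term splits \<open>G F\<close> into its factors, whereas the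
    remainder keeps \<open>G F\<close> together to gain another factor \<open>e\<close>.\<close>
  have L_le: "?m L \<le> ?n (?G ** ?F) * (?n A * ?m X)"
    unfolding L_def using mult(2)[of "?G ** ?F" "A ** X"] mult(2)[of A X] nonneg
    by (meson mult_left_mono order_trans)
  also have "\<dots> \<le> (?n ?G * ?n ?F) * (?n A * ?m X)"
    by (intro mult_right_mono mult(1) mult_nonneg_nonneg nonneg)
  finally have L_le_first: "?m L \<le> (?n ?G * ?n ?F) * (?n A * ?m X)" .
  have second: "e * ?m L \<le> ?n A / cmod t * e\<^sup>2 * ?m X"
  proof (cases "t = 0")
    case True
    have "mat t ** ?G ** ?F = 0" unfolding True
      by (simp add: matrix_eq matrix_vector_mul_assoc[symmetric] mat_mult_vector)
    moreover have "?n 0 \<le> 0"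
      by (rule induced_norm_least[OF Nn Nn]) (simp add: Nn)
    ultimately have "e = 0" using e by simp
    then show ?thesis by simp
  next
    case False
    have "cmod t * ?n (?G ** ?F) \<le> e"
      using induced_norm_scalar_mult[OF Nn Nn, of t "?G ** ?F"] by (simp add: e matrix_mul_assoc)
    then have "?n (?G ** ?F) \<le> e / cmod t" using False by (simp add: field_simps)
    then have "?m L \<le> e / cmod t * (?n A * ?m X)"
      using L_le nonneg by (meson mult_nonneg_nonneg mult_right_mono order_trans)
    then have "e * ?m L \<le> e * (e / cmod t * (?n A * ?m X))"
      using e by (intro mult_left_mono)
    then show ?thesis by (simp add: power2_eq_square mult_ac)
  qed
  have "?m D \<le> (?n A * ?n ?G * ?n ?F + 2 * ?n A / cmod t * e\<^sup>2) * ?m X"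
    using D_le L_le_first second by (simp add: algebra_simps)
  moreover have "?m (X - Xt) = ?m D"
  proof -
    have "(X - Xt) *v x = - (D *v x)" for x
      by (simp add: D_def algebra_simps)
    then show ?thesis by (simp add: induced_norm_def vector_norm_minus[OF Nn])
  qed
  ultimately show ?thesis using Xpos by (simp add: pos_divide_le_eq e_def)
qed

theorem theorem4p3:
  fixes A :: "real^'n^'n" and \<tau> :: "nat \<Rightarrow> complex" and \<nu> :: nat
    and Nn :: "complex^'n \<Rightarrow> real" and Np :: "complex^'p \<Rightarrow> real"
  assumes "vector_norm Nn" and "vector_norm Np"
    and "invertible A"
    and "\<forall>i\<in>{1..\<nu>}. invertible (cmatrix A - mat (\<tau> i))"
  defines "Ainv \<equiv> matrix_inv (cmatrix A)"
  shows "\<forall>i\<in>{1..\<nu>}.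
    (\<forall>B :: real^'p^'n. (cmatrix A - mat (\<tau> i)) ** sol_X (\<tau> i) Ainv (cmatrix B) = cmatrix B) \<and>
    (\<exists>C \<delta>. 0 < \<delta> \<and>
      (\<forall>(B :: real^'p^'n) (Kt :: complex^'n^'n).
        B \<noteq> 0 \<longrightarrow> perturbation_eps Nn (\<tau> i) Ainv Kt < \<delta> \<longrightarrow>
        induced_norm Np Nn (sol_X (\<tau> i) Ainv (cmatrix B) - sol_X (\<tau> i) Kt (cmatrix B))
            / induced_norm Np Nn (sol_X (\<tau> i) Ainv (cmatrix B))
          \<le> condition_number Nn (cmatrix A) * induced_norm Nn Nn (resolvent (\<tau> i) Ainv)
              * (induced_norm Nn Nn (Kt - Ainv) / induced_norm Nn Nn Ainv)
            + C * (perturbation_eps Nn (\<tau> i) Ainv Kt)\<^sup>2))"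
proof
  fix i assume "i \<in> {1..\<nu>}"
  then have inv_shift: "invertible (cmatrix A - mat (\<tau> i))" using assms(4) by blast
  have AK: "cmatrix A ** Ainv = mat 1" and KA: "Ainv ** cmatrix A = mat 1"
    using matrix_inv_inverse[OF cmatrix_invertible[OF \<open>invertible A\<close>]]
    by (simp_all add: Ainv_def)
  have inv: "invertible (mat 1 - mat (\<tau> i) ** Ainv)"
    using invertible_one_minus_scaled_inverse[OF inv_shift KA AK] .
  have "Ainv \<noteq> 0"
  proof
    assume "Ainv = 0"
    then have "mat 1 *v x = (0 :: complex^'n)" for x
      unfolding AK[symmetric] by (simp add: matrix_vector_mul_assoc[symmetric])
    then have "axis undefined 1 = (0 :: complex^'n)" by (metis matrix_vector_mul_lid)
    then show False by (simp add: axis_eq_0_iff)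
  qed
  then have Kpos: "induced_norm Nn Nn Ainv > 0"
    by (rule induced_norm_pos[OF assms(1) assms(1)])
  have bound: "induced_norm Np Nn (sol_X (\<tau> i) Ainv (cmatrix B) - sol_X (\<tau> i) Kt (cmatrix B))
        / induced_norm Np Nn (sol_X (\<tau> i) Ainv (cmatrix B))
      \<le> condition_number Nn (cmatrix A) * induced_norm Nn Nn (resolvent (\<tau> i) Ainv)
          * (induced_norm Nn Nn (Kt - Ainv) / induced_norm Nn Nn Ainv)
        + (2 * induced_norm Nn Nn (cmatrix A) / cmod (\<tau> i)) * (perturbation_eps Nn (\<tau> i) Ainv Kt)\<^sup>2"
    if "B \<noteq> 0" "perturbation_eps Nn (\<tau> i) Ainv Kt < 1 / 2" for B :: "real^'p^'n" and Kt
  proof -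
    have "cmatrix B \<noteq> 0" using that(1) by (simp add: vec_eq_iff)
    from relative_error_bound[OF assms(1,2) AK inv this that(2)] Kpos
    show ?thesis by (simp add: condition_number_def Ainv_def[symmetric])
  qed
  show "(\<forall>B :: real^'p^'n. (cmatrix A - mat (\<tau> i)) ** sol_X (\<tau> i) Ainv (cmatrix B) = cmatrix B) \<and>
    (\<exists>C \<delta>. 0 < \<delta> \<and>
      (\<forall>(B :: real^'p^'n) (Kt :: complex^'n^'n).
        B \<noteq> 0 \<longrightarrow> perturbation_eps Nn (\<tau> i) Ainv Kt < \<delta> \<longrightarrow>
        induced_norm Np Nn (sol_X (\<tau> i) Ainv (cmatrix B) - sol_X (\<tau> i) Kt (cmatrix B))
            / induced_norm Np Nn (sol_X (\<tau> i) Ainv (cmatrix B))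
          \<le> condition_number Nn (cmatrix A) * induced_norm Nn Nn (resolvent (\<tau> i) Ainv)
              * (induced_norm Nn Nn (Kt - Ainv) / induced_norm Nn Nn Ainv)
            + C * (perturbation_eps Nn (\<tau> i) Ainv Kt)\<^sup>2))"
    using sol_X_solves[OF AK inv] bound
    by (intro conjI allI exI[of _ "2 * induced_norm Nn Nn (cmatrix A) / cmod (\<tau> i)"]
        exI[of _ "1 / 2 :: real"] impI) simp_all
qed

end
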